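(* Let $k,s\geq 1$ be integers and let $G$ be a 2-connected graph on $n\geq 2k(s+1)$ vertices. If $\max\{d(v):v\in S\}\geq k$ for every independent set $S\subset V(G)$ with $|S|=s+1$, then $c(G)\geq 2k$.
   Context: All graphs are simple and finite. A 2-connected graph has at least 3 vertices, is connected, and has no cut-vertex. $d(v)$ is the degree of $v$ in $G$. The circumference $c(G)$ is the length (number of edges) of a longest cycle in $G$. *)

theory Defs
  imports "Graph_Theory.Graph_Theory"
begin

text \<open>
  A finite simple graph is represented by a value satisfying the locale predicate
  \<^const>\<open>graph\<close>: a finite digraph without loops and parallel arcs whose adjacency
  relation is symmetric. An undirected edge \<open>uv\<close> is thus a pair of opposite arcs, and the
  degree of \<open>v\<close> (its number of neighbours) is \<^term>\<open>out_degree G v\<close>.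
\<close>

definition independent_set :: "('a, 'b) pre_digraph \<Rightarrow> 'a set \<Rightarrow> bool" where
  "independent_set G S \<longleftrightarrow> S \<subseteq> verts G \<and> (\<forall>u\<in>S. \<forall>v\<in>S. \<not> u \<rightarrow>\<^bsub>G\<^esub> v)"

text \<open>
  A cut-vertex is a vertex whose deletion separates two other vertices of the same
  component, i.e. increases the number of components.
\<close>

definition cut_vertex :: "('a, 'b) pre_digraph \<Rightarrow> 'a \<Rightarrow> bool" where
  "cut_vertex G v \<longleftrightarrow> v \<in> verts G \<and>
    (\<exists>x \<in> verts G - {v}. \<exists>y \<in> verts G - {v}.
      x \<rightarrow>\<^sup>*\<^bsub>G\<^esub> y \<and> \<not> x \<rightarrow>\<^sup>*\<^bsub>pre_digraph.del_vert G v\<^esub> y)"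

definition two_connected :: "('a, 'b) pre_digraph \<Rightarrow> bool" where
  "two_connected G \<longleftrightarrow> card (verts G) \<ge> 3 \<and> connected G \<and> \<not> (\<exists>v. cut_vertex G v)"

text \<open>
  The library's directed \<^const>\<open>pre_digraph.cycle\<close> also admits the closed walk \<open>u, v, u\<close>
  along the two arcs of a single edge. The length condition excludes it; the remaining
  cycles are exactly the cycles of the undirected graph, each with a start and an orientation.
\<close>

definition ugraph_cycle :: "('a, 'b) pre_digraph \<Rightarrow> 'b awalk \<Rightarrow> bool" where
  "ugraph_cycle G p \<longleftrightarrow> pre_digraph.cycle G p \<and> length p \<ge> 3"

text \<open>Only meaningful for finite graphs with at least one cycle (e.g. finite 2-connected ones).\<close>

definition circumference :: "('a, 'b) pre_digraph \<Rightarrow> nat" where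
  "circumference G = Max {length p | p. ugraph_cycle G p}"

end

theory Submission
  imports Defs
begin

text \<open>
  Suppose \<open>c(G) < 2k\<close> and let \<open>C\<close> be a longest cycle. Let \<open>W\<close> be a component of \<open>G - C\<close> with \<open>m\<close>
  neighbours on \<open>C\<close>. A path of length \<open>l\<close> through \<open>W\<close> between two of them forces
  \<open>|C| \<ge> 2l + 2(m - 2)\<close>, because every further neighbour of \<open>W\<close> lengthens the arc containing it by
  two. Hence \<open>l < k - m + 2\<close>. Contract all neighbours of \<open>W\<close> but one to a single vertex; this costs a
  vertex of \<open>W\<close> at most \<open>m - 2\<close> of its degree, so a vertex of degree at least \<open>k\<close> keeps degree at
  least \<open>k - m + 2\<close>.

  It therefore suffices to treat two terminals \<open>x\<close>, \<open>y\<close> joined through a set \<open>D\<close> only by paths of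
  length less than \<open>d\<close>, where \<open>d \<le> k\<close>. Then \<open>D\<close> contains an independent set \<open>I\<close> of vertices of degree
  less than \<open>d\<close> with \<open>|D| \<le> (2|I| - 1)(k - 2)\<close>. Remove the at most \<open>d - 2 \<le> k - 2\<close> inner vertices of a
  longest such path and apply induction to the components left, contracted as above. If there are at
  least two components, their bounds add up with \<open>k - 2\<close> to spare. If there is at most one, it has no
  two consecutive neighbours on the path, so some inner vertex has no neighbour in it; the degree of
  that vertex is less than \<open>d\<close>, and it can be added to \<open>I\<close>.

  Summed over the components of \<open>G - C\<close>, this gives \<open>2ks < |G - C| \<le> (2|I| - 1)(k - 2)\<close>, so \<open>I\<close> has
  more than \<open>s\<close> vertices, all of degree less than \<open>k\<close>.
\<close>

section \<open>Detours through connected sets\<close>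

text \<open>Relation and ambient set are explicit arguments because the induction passes to
  contracted graphs, which are new relations on vertices of the same type.\<close>

definition nbrs :: "('a \<Rightarrow> 'a \<Rightarrow> bool) \<Rightarrow> 'a set \<Rightarrow> 'a set \<Rightarrow> 'a set" where
  "nbrs E Z U = {u \<in> Z - U. \<exists>w\<in>U. E w u}"

text \<open>Connectedness in cut form, ready for splitting a set and for finding a neighbour inside
  it; the empty set qualifies.\<close>

definition conn_on :: "('a \<Rightarrow> 'a \<Rightarrow> bool) \<Rightarrow> 'a set \<Rightarrow> bool" where
  "conn_on E W \<longleftrightarrow> (\<forall>U\<subseteq>W. U \<noteq> {} \<longrightarrow> U \<noteq> W \<longrightarrow> (\<exists>u\<in>U. \<exists>v\<in>W - U. E u v))"

text \<open>The end vertices \<open>a\<close> and \<open>b\<close> are not part of \<open>w\<close>, and \<open>a = b\<close> is possible.\<close>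

definition through :: "('a \<Rightarrow> 'a \<Rightarrow> bool) \<Rightarrow> 'a set \<Rightarrow> 'a \<Rightarrow> 'a list \<Rightarrow> 'a \<Rightarrow> bool" where
  "through E W a w b \<longleftrightarrow> w \<noteq> [] \<and> distinct w \<and> set w \<subseteq> W \<and> successively E (a # w @ [b])"

text \<open>The inequality is |U| \<le> (2|I| - t)c, kept free of subtraction: \<open>t\<close>
  counts the units of \<open>c\<close> to spare, and it adds up over parts that no edge joins.
  Degrees are taken in \<open>Z\<close>.\<close>

definition sparse_bound ::
    "('a \<Rightarrow> 'a \<Rightarrow> bool) \<Rightarrow> 'a set \<Rightarrow> nat \<Rightarrow> nat \<Rightarrow> nat \<Rightarrow> 'a set \<Rightarrow> bool" where
  "sparse_bound E Z d c t U \<longleftrightarrow> (\<exists>I\<subseteq>U. (\<forall>u\<in>I. \<forall>v\<in>I. \<not> E u v) \<and>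
     (\<forall>v\<in>I. card {u \<in> Z. E v u} < d) \<and> card U + t * c \<le> 2 * card I * c)"

lemma through_rev:
  assumes "symp E" "through E W a w b"
  shows "through E W b (rev w) a"
proof -
  have "successively (\<lambda>x y. E y x) (a # w @ [b])"
    using assms unfolding through_def by (auto intro: successively_mono dest: sympD)
  then have "successively E (rev (a # w @ [b]))"
    by (simp only: successively_rev)
  then show ?thesis using assms(2) by (simp add: through_def)
qed

lemma through_mono:
  "through E W a w b \<Longrightarrow> W \<subseteq> W' \<Longrightarrow> through E W' a w b"
  by (auto simp: through_def)

lemma through_iff:
  "through E W a w b \<longleftrightarrow> w \<noteq> [] \<and> distinct w \<and> set w \<subseteq> W \<and> successively E w \<and>
     E a (hd w) \<and> E (last w) b"
  by (auto simp: through_def successively_append_iff successively_Cons)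

text \<open>The path meets \<open>S\<close> only in its end \<open>c\<close>. The starting points of
  such paths include \<open>S\<close> (take \<open>z = []\<close>). An edge from one of them to
  another vertex of \<open>W\<close> prolongs a path at its front; if the new vertex already lies on
  the path, the final segment from there serves.\<close>

lemma conn_on_link:
  assumes "symp E" "conn_on E W" "S \<subseteq> W" "S \<noteq> {}" "f \<in> W"
  obtains z c where "distinct (z @ [c])" "set z \<subseteq> W - S" "c \<in> S"
    "successively E (z @ [c])" "hd (z @ [c]) = f"
proof -
  define good where "good f z c \<longleftrightarrow> distinct (z @ [c]) \<and> set z \<subseteq> W - S \<and> c \<in> S \<and>
    successively E (z @ [c]) \<and> hd (z @ [c]) = f" for f z c
  define U where "U = {f \<in> W. \<exists>z c. good f z c}"
  have SU: "S \<subseteq> U"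
  proof
    fix f assume "f \<in> S"
    then have "good f [] f" by (simp add: good_def)
    then show "f \<in> U" using assms(3) \<open>f \<in> S\<close> by (auto simp: U_def)
  qed
  have "U = W"
  proof (rule ccontr)
    assume "U \<noteq> W"
    moreover have "U \<subseteq> W" by (auto simp: U_def)
    ultimately obtain v u where vu: "v \<in> U" "u \<in> W - U" "E v u"
      using assms(2,4) SU unfolding conn_on_def by (metis subset_empty)
    then obtain z c where g: "good v z c" by (auto simp: U_def)
    have "u \<notin> S" using SU vu by auto
    have "u \<notin> set z"
    proof
      assume "u \<in> set z"
      then obtain z1 z2 where z: "z = z1 @ u # z2" by (meson split_list)
      have "good u (u # z2) c"
        using g unfolding good_def z by (auto simp: successively_append_iff)
      then show False using vu by (auto simp: U_def)
    qed
    moreover have "E u v" using assms(1) vu by (auto dest: sympD)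
    ultimately have "good u (u # z) c"
      using g \<open>u \<notin> S\<close> vu unfolding good_def by (auto simp: successively_Cons)
    then show False using vu by (auto simp: U_def)
  qed
  then show thesis using assms(5) that by (auto simp: U_def good_def)
qed

lemma conn_on_through:
  assumes "symp E" "conn_on E W" "f \<in> W" "g \<in> W" "E a f" "E g b"
  obtains w where "through E W a w b"
proof -
  obtain z c where "distinct (z @ [c])" "set z \<subseteq> W - {g}" "c \<in> {g}"
    "successively E (z @ [c])" "hd (z @ [c]) = f"
    using conn_on_link[of E W "{g}" f] assms by auto
  then have "through E W a (z @ [c]) b"
    using assms by (auto simp: through_iff)
  then show thesis by (rule that)
qed

text \<open>Attaching an intermediate neighbour to the given detour splits the arc into two shorter
  arcs whose detours are together longer by at least two.\<close>

lemma detour_arc: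
  fixes v :: "nat \<Rightarrow> 'a"
  assumes sym: "symp E" and conn: "conn_on E W"
    and "i < j"
    and "\<And>i' j' w. i \<le> i' \<Longrightarrow> i' < j' \<Longrightarrow> j' \<le> j \<Longrightarrow> through E W (v i') w (v j')
      \<Longrightarrow> length w + 1 \<le> j' - i'"
    and "through E W (v i) w (v j)"
  shows "length w + 1 + 2 * card {l. i < l \<and> l < j \<and> (\<exists>f\<in>W. E (v l) f)} \<le> j - i"
  using assms(3-)
proof (induction "j - i" arbitrary: i j w rule: less_induct)
  case less
  let ?M = "\<lambda>i j. {l. i < l \<and> l < j \<and> (\<exists>f\<in>W. E (v l) f)}"
  have fin: "finite (?M i j)" for i j by (rule finite_subset[of _ "{..<j}"]) auto
  show ?case
  proof (cases "?M i j = {}")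
    case True
    show ?thesis unfolding True using less.prems(2)[of i j w] less.prems(1,3) by simp
  next
    case False
    then obtain l f where l: "i < l" "l < j" "f \<in> W" "E (v l) f" by auto
    have w: "w \<noteq> []" "distinct w" "set w \<subseteq> W" "successively E w" "E (v i) (hd w)" "E (last w) (v j)"
      using less.prems(3) by (auto simp: through_iff)
    \<comment> \<open>\<open>c\<close> is the first vertex of the old detour met on the way from
      \<open>f\<close>. Both new detours use \<open>z\<close> and \<open>c\<close>, so their
      lengths, each counted with its \<open>+ 1\<close>, sum to \<open>length w + 1\<close> plus
      \<open>2 + 2 * length z\<close>; the 2 pays for \<open>l\<close>.\<close>
    obtain z c where z: "distinct (z @ [c])" "set z \<subseteq> W - set w" "c \<in> set w"
      "successively E (z @ [c])" "hd (z @ [c]) = f"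
      using conn_on_link[OF sym conn w(3) _ l(3)] w(1) by auto
    obtain w1 w2 where ws: "w = w1 @ c # w2" using z(3) by (meson split_list)
    have "E f (v l)" using l(4) sym by (auto dest: sympD)
    have srev: "successively E (c # rev z)"
    proof -
      have "successively (\<lambda>x y. E y x) (z @ [c])"
        using z(4) sym by (auto intro: successively_mono dest: sympD)
      then have "successively E (rev (z @ [c]))" by (simp only: successively_rev)
      then show ?thesis by simp
    qed
    have lastz: "last (c # rev z) = f"
      using z(5) by (cases z) auto
    have "through E W (v i) (w1 @ c # rev z) (v l)"
      using w z ws srev lastz \<open>E f (v l)\<close>
      by (auto simp: through_iff successively_append_iff hd_append successively_Cons)
    moreover have "through E W (v l) (z @ c # w2) (v j)"
      using w z ws l(4)
      by (auto simp: through_iff successively_append_iff hd_append successively_Cons split: if_splits)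
    ultimately have "length (w1 @ c # rev z) + 1 + 2 * card (?M i l) \<le> l - i"
      "length (z @ c # w2) + 1 + 2 * card (?M l j) \<le> j - l"
      using less.hyps[of l i "w1 @ c # rev z"] less.hyps[of j l "z @ c # w2"] l less.prems(2)
      by auto
    moreover have "?M i j = insert l (?M i l \<union> ?M l j)" using l by auto
    then have "card (?M i j) \<le> 1 + card (?M i l) + card (?M l j)"
      using card_Un_le[of "?M i l" "?M l j"] by (simp add: card_insert_if fin)
    ultimately show ?thesis using l ws by simp
  qed
qed

section \<open>Sparse independent sets and contraction\<close>

text \<open>A smallest nonempty subset of \<open>D\<close> without edges to the rest of
  \<open>D\<close> is connected, since a violating cut would give a smaller one.\<close>

lemma ex_component:
  assumes "finite D" "D \<noteq> {}" "symp E"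
  obtains W where "W \<subseteq> D" "W \<noteq> {}" "conn_on E W" "\<forall>u\<in>W. \<forall>v\<in>D - W. \<not> E u v"
proof -
  let ?P = "\<lambda>W. W \<subseteq> D \<and> W \<noteq> {} \<and> (\<forall>u\<in>W. \<forall>v\<in>D - W. \<not> E u v)"
  define W where "W = arg_min card ?P"
  have P: "?P W" and min: "\<And>U. ?P U \<Longrightarrow> card W \<le> card U"
    unfolding W_def
    using arg_min_natI[of ?P D card] arg_min_nat_le[of ?P _ card] assms(2) by blast+
  have "conn_on E W"
    unfolding conn_on_def
  proof (intro allI impI, rule ccontr)
    fix U assume U: "U \<subseteq> W" "U \<noteq> {}" "U \<noteq> W" "\<not> (\<exists>u\<in>U. \<exists>v\<in>W - U. E u v)"
    then have "?P U" using P by blast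
    then have "card W \<le> card U" by (rule min)
    moreover have "finite W" using P assms(1) finite_subset by blast
    ultimately show False using U by (meson card_seteq)
  qed
  then show thesis using P that by blast
qed

lemma sparse_bound_Un:
  assumes "sparse_bound E Z d c s U" "sparse_bound E Z d c t V"
    and "finite U" "finite V" "U \<inter> V = {}" "symp E" "\<forall>u\<in>U. \<forall>v\<in>V. \<not> E u v"
  shows "sparse_bound E Z d c (s + t) (U \<union> V)"
proof -
  obtain I where I: "I \<subseteq> U" "\<forall>u\<in>I. \<forall>v\<in>I. \<not> E u v" "\<forall>v\<in>I. card {u \<in> Z. E v u} < d"
    "card U + s * c \<le> 2 * card I * c"
    using assms(1) by (auto simp: sparse_bound_def)
  obtain J where J: "J \<subseteq> V" "\<forall>u\<in>J. \<forall>v\<in>J. \<not> E u v" "\<forall>v\<in>J. card {u \<in> Z. E v u} < d"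
    "card V + t * c \<le> 2 * card J * c"
    using assms(2) by (auto simp: sparse_bound_def)
  have "card (I \<union> J) = card I + card J"
    using I(1) J(1) assms(3-5) by (intro card_Un_disjoint) (auto intro: finite_subset)
  moreover have "card (U \<union> V) = card U + card V"
    using assms(3-5) by (rule card_Un_disjoint)
  ultimately have "card (U \<union> V) + (s + t) * c \<le> 2 * card (I \<union> J) * c"
    using I(4) J(4) by (simp add: algebra_simps)
  moreover have "\<forall>u\<in>I \<union> J. \<forall>v\<in>I \<union> J. \<not> E u v"
    using I(1,2) J(1,2) assms(6,7) by (blast dest: sympD)
  ultimately show ?thesis
    unfolding sparse_bound_def using I J by (intro exI[of _ "I \<union> J"]) blast
qed

lemma sparse_bound_le:
  assumes "sparse_bound E Z d c t U" "s \<le> t"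
  shows "sparse_bound E Z d c s U"
proof -
  have "card U + s * c \<le> card U + t * c" using assms(2) by simp
  then show ?thesis using assms(1) unfolding sparse_bound_def by (meson order_trans)
qed

text \<open>A disconnected \<open>W\<close> splits along a cut without edges. Each side inherits a
  surplus of at least one from its components, and the two add; anything beyond that is
  discarded.\<close>

lemma sparse_bound_components:
  assumes "finite W" "W \<noteq> {}" "symp E"
    and "\<And>U. U \<subseteq> W \<Longrightarrow> U \<noteq> {} \<Longrightarrow> conn_on E U \<Longrightarrow> \<forall>u\<in>U. \<forall>v\<in>W - U. \<not> E u v
      \<Longrightarrow> sparse_bound E Z d c 1 U"
  shows "sparse_bound E Z d c (if conn_on E W then 1 else 2) W"
  using assms(1,2,4)
proof (induction "card W" arbitrary: W rule: less_induct)
  case less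
  show ?case
  proof (cases "conn_on E W")
    case True
    then show ?thesis using less.prems by auto
  next
    case False
    then obtain U where U: "U \<subseteq> W" "U \<noteq> {}" "U \<noteq> W" "\<forall>u\<in>U. \<forall>v\<in>W - U. \<not> E u v"
      unfolding conn_on_def by blast
    let ?V = "W - U"
    have U': "\<forall>u\<in>?V. \<forall>v\<in>U. \<not> E u v" using U(4) assms(3) by (blast dest: sympD)
    have "sparse_bound E Z d c 1 U"
    proof (rule sparse_bound_le)
      show "sparse_bound E Z d c (if conn_on E U then 1 else 2) U"
      proof (rule less.hyps)
        show "card U < card W" using U less.prems(1) by (meson psubset_card_mono psubsetI)
        show "finite U" using U less.prems(1) finite_subset by blast
        fix T assume T: "T \<subseteq> U" "T \<noteq> {}" "conn_on E T" "\<forall>u\<in>T. \<forall>v\<in>U - T. \<not> E u v"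
        then show "sparse_bound E Z d c 1 T" using U by (intro less.prems(3)) blast+
      qed fact
    qed simp
    moreover have "sparse_bound E Z d c 1 ?V"
    proof (rule sparse_bound_le)
      show "sparse_bound E Z d c (if conn_on E ?V then 1 else 2) ?V"
      proof (rule less.hyps)
        show "card ?V < card W" using U less.prems(1)
          by (intro psubset_card_mono) auto
        show "?V \<noteq> {}" using U by auto
        show "finite ?V" using less.prems(1) by simp
        fix T assume T: "T \<subseteq> ?V" "T \<noteq> {}" "conn_on E T" "\<forall>u\<in>T. \<forall>v\<in>?V - T. \<not> E u v"
        then show "sparse_bound E Z d c 1 T" using U' by (intro less.prems(3)) blast+
      qed
    qed simp
    ultimately have "sparse_bound E Z d c (1 + 1) (U \<union> ?V)"
      using U less.prems(1) assms(3) by (intro sparse_bound_Un) (auto intro: finite_subset)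
    moreover have "U \<union> ?V = W" using U by auto
    ultimately show ?thesis using False by (simp add: numeral_2_eq_2)
  qed
qed

text \<open>The neighbours of \<open>W\<close> are contracted to \<open>a\<close> and one further vertex \<open>y\<close>: a vertex loses
  at most \<open>m - 2\<close> of its degree, where \<open>m\<close> is the number of neighbours of \<open>W\<close>, and
  connectedness of \<open>W\<close> is what keeps the contracted graph 2-connected.\<close>

lemma sparse_bound_contract:
  assumes sym: "symp E" and irr: "irreflp E" and fin: "finite Z" and W: "W \<subseteq> Z" "W \<noteq> {}"
    and conn: "conn_on E W"
    and nb: "\<And>U. U \<subseteq> W \<Longrightarrow> U \<noteq> {} \<Longrightarrow> 2 \<le> card (nbrs E Z U)"
    and a: "a \<in> nbrs E Z W"
    and short: "\<And>b w. b \<in> nbrs E Z W \<Longrightarrow> b \<noteq> a \<Longrightarrow> through E W a w b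
      \<Longrightarrow> length w + 1 + card (nbrs E Z W) < d + 2"
    and linked: "\<And>E' x y d'. symp E' \<Longrightarrow> irreflp E' \<Longrightarrow> x \<noteq> y \<Longrightarrow> x \<notin> W \<Longrightarrow> y \<notin> W
      \<Longrightarrow> (\<And>U. U \<subseteq> W \<Longrightarrow> U \<noteq> {} \<Longrightarrow> 2 \<le> card (nbrs E' (insert x (insert y W)) U))
      \<Longrightarrow> (\<And>w. through E' W x w y \<Longrightarrow> length w + 1 < d') \<Longrightarrow> d' \<le> k
      \<Longrightarrow> sparse_bound E' (insert x (insert y W)) d' c 1 W"
    and "d \<le> k"
  shows "sparse_bound E Z d c 1 W"
proof -
  let ?A = "nbrs E Z W"
  let ?m = "card ?A"
  have finA: "finite ?A" using fin by (simp add: nbrs_def)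
  have m2: "2 \<le> ?m" using nb[of W] W by simp
  have "?A \<noteq> {a}"
  proof
    assume "?A = {a}"
    then have "?m = 1" by simp
    then show False using m2 by simp
  qed
  then obtain y where y: "y \<in> ?A" "y \<noteq> a" using a by blast
  have aW: "a \<notin> W" and yW: "y \<notin> W" using a y by (auto simp: nbrs_def)
  \<comment> \<open>One of the contracted neighbours, \<open>y\<close>, itself stands for all of
    \<open>?A - {a}\<close>, so no fresh vertex is required. Only edges with an end in
    \<open>W\<close> are kept.\<close>
  define F where "F u v \<longleftrightarrow> u \<in> W \<and> (v \<in> W \<and> E u v \<or> v = a \<and> E u a \<or>
    v = y \<and> (\<exists>b\<in>?A - {a}. E u b))" for u v
  define E' where "E' u v \<longleftrightarrow> F u v \<or> F v u" for u v
  have E'W: "E' u v \<longleftrightarrow> E u v" if "u \<in> W" "v \<in> W" for u v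
    using that aW yW sym by (auto simp: E'_def F_def dest: sympD)
  have E'a: "E' u a \<longleftrightarrow> E u a" "E' a u \<longleftrightarrow> E u a" if "u \<in> W" for u
    using that aW yW y by (auto simp: E'_def F_def)
  have E'y: "E' u y \<longleftrightarrow> (\<exists>b\<in>?A - {a}. E u b)" "E' y u \<longleftrightarrow> (\<exists>b\<in>?A - {a}. E u b)" if "u \<in> W" for u
    using that aW yW y by (auto simp: E'_def F_def)
  have sym': "symp E'" by (auto simp: E'_def intro!: sympI)
  have irr': "irreflp E'"
    using irr aW yW by (auto simp: E'_def F_def irreflp_def)
  let ?Z' = "insert a (insert y W)"
  have nb': "2 \<le> card (nbrs E' ?Z' U)" if U: "U \<subseteq> W" "U \<noteq> {}" for U
  proof -
    have fin': "finite (nbrs E' ?Z' U)"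
      using finite_subset[OF W(1) fin] by (simp add: nbrs_def)
    have "\<exists>p q. p \<noteq> q \<and> p \<in> nbrs E' ?Z' U \<and> q \<in> nbrs E' ?Z' U"
    proof (cases "U = W")
      case True
      have "a \<in> nbrs E' ?Z' U" using a aW True by (auto simp: nbrs_def E'a)
      moreover have "y \<in> nbrs E' ?Z' U" using y yW True by (auto simp: nbrs_def E'y)
      ultimately show ?thesis using y(2) by blast
    next
      case False
      \<comment> \<open>Connectedness supplies a neighbour \<open>p\<close> inside \<open>W\<close>,
        where nothing is merged; hence a second neighbour \<open>q\<close> remains distinct from
        \<open>p\<close> whatever it is contracted to.\<close>
      then obtain u p where p: "u \<in> U" "p \<in> W - U" "E u p"
        using conn U unfolding conn_on_def by blast
      have "nbrs E Z U \<noteq> {p}"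
      proof
        assume "nbrs E Z U = {p}"
        then have "card (nbrs E Z U) = 1" by simp
        then show False using nb[OF U] by simp
      qed
      moreover have "p \<in> nbrs E Z U" using p W by (auto simp: nbrs_def)
      ultimately obtain q where q: "q \<in> nbrs E Z U" "q \<noteq> p" by blast
      have pn: "p \<in> nbrs E' ?Z' U" using p U E'W[of u p] by (auto simp: nbrs_def)
      show ?thesis
      proof (cases "q \<in> W")
        case True
        then have "q \<in> nbrs E' ?Z' U" using q U E'W by (force simp: nbrs_def)
        then show ?thesis using pn q(2) by blast
      next
        case False
        then have qA: "q \<in> ?A" using q U by (auto simp: nbrs_def)
        obtain u' where u': "u' \<in> U" "E u' q" using q by (auto simp: nbrs_def)
        show ?thesis
        proof (cases "q = a")
          case True
          then have "a \<in> nbrs E' ?Z' U" using u' U aW E'a by (force simp: nbrs_def)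
          then show ?thesis using pn p aW by (intro exI[of _ a] exI[of _ p]) auto
        next
          case False
          then have "E' u' y" using u' U qA E'y by blast
          then have "y \<in> nbrs E' ?Z' U" using u' U yW by (auto simp: nbrs_def)
          then show ?thesis using pn p yW by (intro exI[of _ y] exI[of _ p]) auto
        qed
      qed
    qed
    then obtain p q where "p \<noteq> q" "{p, q} \<subseteq> nbrs E' ?Z' U" by blast
    then show ?thesis using card_mono[OF fin', of "{p, q}"] by simp
  qed
  have short': "length w + 1 < d + 2 - ?m" if w: "through E' W a w y" for w
  proof -
    have w': "w \<noteq> []" "distinct w" "set w \<subseteq> W" "successively E' w" "E' a (hd w)" "E' (last w) y"
      using w by (auto simp: through_iff)
    have "successively E w"
      using w'(4) by (rule successively_mono) (use w'(3) E'W in blast)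
    moreover have "hd w \<in> W" "last w \<in> W" using w'(1,3) by auto
    \<comment> \<open>The last edge of the path, into \<open>y\<close>, is lifted to an edge into
      some contracted neighbour \<open>b\<close>.\<close>
    moreover obtain b where b: "b \<in> ?A - {a}" "E (last w) b"
      using w'(6) \<open>last w \<in> W\<close> E'y by blast
    moreover have "E a (hd w)" using w'(5) \<open>hd w \<in> W\<close> E'a sym by (blast dest: sympD)
    ultimately have "through E W a w b" using w' by (simp add: through_iff)
    then show ?thesis using short[of b w] b by auto
  qed
  have "sparse_bound E' ?Z' (d + 2 - ?m) c 1 W"
    using linked[OF sym' irr' y(2)[symmetric] aW yW nb' short'] m2 \<open>d \<le> k\<close> by simp
  then obtain I where I: "I \<subseteq> W" "\<forall>u\<in>I. \<forall>v\<in>I. \<not> E' u v"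
    "\<forall>v\<in>I. card {u \<in> ?Z'. E' v u} < d + 2 - ?m" "card W + 1 * c \<le> 2 * card I * c"
    unfolding sparse_bound_def by blast
  have "card {u \<in> Z. E v u} < d" if "v \<in> I" for v
  proof -
    have vW: "v \<in> W" using that I(1) by blast
    have finW: "finite W" using fin W finite_subset by blast
    let ?B = "{u \<in> W. E v u}"
    have B: "finite ?B" using finW by simp
    define \<alpha> where "\<alpha> = (if E v a then {a} else {})"
    define \<beta> where "\<beta> = {b \<in> ?A - {a}. E v b}"
    have "{u \<in> Z. E v u} \<subseteq> ?B \<union> \<alpha> \<union> \<beta>"
      using vW by (auto simp: \<alpha>_def \<beta>_def nbrs_def)
    then have "card {u \<in> Z. E v u} \<le> card (?B \<union> \<alpha> \<union> \<beta>)"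
      using B finA by (intro card_mono) (auto simp: \<alpha>_def \<beta>_def)
    also have "\<dots> \<le> card ?B + card \<alpha> + card \<beta>"
      by (meson card_Un_le add_le_mono1 order_trans)
    finally have 1: "card {u \<in> Z. E v u} \<le> card ?B + card \<alpha> + card \<beta>" .
    define \<gamma> where "\<gamma> = (if \<beta> = {} then {} else {y})"
    have "card (?B \<union> \<alpha> \<union> \<gamma>) = card ?B + card \<alpha> + card \<gamma>"
      using aW yW y B by (subst card_Un_disjoint; (subst card_Un_disjoint)?) (auto simp: \<alpha>_def \<gamma>_def)
    moreover have "?B \<union> \<alpha> \<union> \<gamma> \<subseteq> {u \<in> ?Z'. E' v u}"
      using vW E'W E'a E'y by (auto simp: \<alpha>_def \<beta>_def \<gamma>_def split: if_splits)
    then have "card (?B \<union> \<alpha> \<union> \<gamma>) \<le> card {u \<in> ?Z'. E' v u}"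
      using finW by (intro card_mono) auto
    \<comment> \<open>A nonempty \<beta> has at most \<open>?m - 1\<close> elements and survives as
      the single vertex \<open>y\<close>, hence the loss of at most \<open>?m - 2\<close>.\<close>
    moreover have "card \<beta> \<le> card \<gamma> + (?m - 2)"
    proof (cases "\<beta> = {}")
      case False
      have "card \<beta> \<le> card (?A - {a})" using finA by (intro card_mono) (auto simp: \<beta>_def)
      also have "\<dots> = ?m - 1" using a by simp
      finally show ?thesis using False m2 by (simp add: \<gamma>_def)
    qed simp
    moreover have "card {u \<in> ?Z'. E' v u} < d + 2 - ?m" using I(3) that by blast
    ultimately show ?thesis using 1 m2 by linarith
  qed
  moreover have "\<forall>u\<in>I. \<forall>v\<in>I. \<not> E u v" using I(1,2) E'W by blast
  ultimately show ?thesis unfolding sparse_bound_def using I(1,4) by blast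
qed

section \<open>Two terminals without a long path\<close>

text \<open>The case \<open>j = length p\<close>, where nothing follows \<open>w\<close>, serves
  detours that close a cycle at its starting vertex.\<close>

lemma successively_replace:
  assumes "successively E p" "i < length p" "j \<le> length p" "w \<noteq> []" "successively E w"
    and "E (p ! i) (hd w)" "j < length p \<Longrightarrow> E (last w) (p ! j)"
  shows "successively E (take (Suc i) p @ w @ drop j p)"
proof -
  have "successively E (take (Suc i) p @ drop (Suc i) p)" using assms(1) by simp
  then have 1: "successively E (take (Suc i) p)" by (simp only: successively_append_iff)
  have "successively E (take j p @ drop j p)" using assms(1) by simp
  then have 2: "successively E (drop j p)" by (simp only: successively_append_iff)
  have "last (take (Suc i) p) = p ! i" using assms(2) by (simp add: take_Suc_conv_app_nth)
  then show ?thesis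
    using 1 2 assms by (cases "j < length p") (auto simp: successively_append_iff hd_drop_conv_nth)
qed

lemma through_longest:
  assumes "finite D" "through E D x w y"
  obtains w0 where "through E D x w0 y" "\<And>w'. through E D x w' y \<Longrightarrow> length w' \<le> length w0"
proof -
  have "length w' < card D + 1" if "through E D x w' y" for w'
    using that assms(1) card_mono[of D "set w'"] by (simp add: through_def distinct_card)
  then show thesis
    using ex_has_greatest_nat[of "\<lambda>w. through E D x w y" w length "card D + 1"] assms(2) that
    by metis
qed

text \<open>The induction ranges over all relations, terminals and thresholds \<open>d\<close>,
  since the components left by a longest path are contracted before the hypothesis applies to them.
  Only \<open>k\<close> is fixed, so that all bounds share the unit \<open>k - 2\<close> and can be
  added.\<close>

lemma sparse_bound_linked:
  assumes "finite D" "D \<noteq> {}" "symp E" "irreflp E" "x \<noteq> y" "x \<notin> D" "y \<notin> D"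
    and "\<And>U. U \<subseteq> D \<Longrightarrow> U \<noteq> {} \<Longrightarrow> 2 \<le> card (nbrs E (insert x (insert y D)) U)"
    and "\<And>w. through E D x w y \<Longrightarrow> length w + 1 < d"
    and "d \<le> k"
  shows "sparse_bound E (insert x (insert y D)) d (k - 2) 1 D"
  using assms
proof (induction "card D" arbitrary: D E x y d rule: less_induct)
  case less
  note finD = less.prems(1) and sym = less.prems(3) and irr = less.prems(4)
  note xy = less.prems(5-7) and nb = less.prems(8) and short = less.prems(9)
  let ?Z = "insert x (insert y D)"
  let ?c = "k - 2"
  have finZ: "finite ?Z" using finD by simp
  obtain w1 where w1: "through E D x w1 y"
  proof -
    obtain W where W: "W \<subseteq> D" "W \<noteq> {}" "conn_on E W" "\<forall>u\<in>W. \<forall>v\<in>D - W. \<not> E u v"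
      using ex_component[OF finD less.prems(2) sym] by blast
    \<comment> \<open>A component has no neighbours except the terminals, and at least two, so it
      attaches to both.\<close>
    have sub: "nbrs E ?Z W \<subseteq> {x, y}" using W by (auto simp: nbrs_def)
    have "2 \<le> card (nbrs E ?Z W)" using nb W by simp
    then have "nbrs E ?Z W = {x, y}" using sub xy by (intro card_seteq) auto
    then have "x \<in> nbrs E ?Z W" "y \<in> nbrs E ?Z W" by simp_all
    then obtain f g where "f \<in> W" "g \<in> W" "E f x" "E g y" by (auto simp: nbrs_def)
    then obtain w where "through E W x w y"
      using conn_on_through[OF sym W(3)] sym by (meson sympD)
    then show thesis using that through_mono W(1) by metis
  qed
  obtain w0 where w0: "through E D x w0 y"
    and longest: "\<And>w'. through E D x w' y \<Longrightarrow> length w' \<le> length w0"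
    using through_longest[OF finD w1] by blast
  have w0': "w0 \<noteq> []" "distinct w0" "set w0 \<subseteq> D" "successively E (x # w0 @ [y])"
    using w0 by (auto simp: through_def)
  let ?n = "length w0"
  have nd: "?n + 1 < d" by (rule short[OF w0])
  \<comment> \<open>As \<open>w0\<close> is nonempty, this forces \<open>k \<ge> 3\<close>, so
    \<open>k - 2\<close> is not truncated.\<close>
  then have nc: "?n \<le> ?c" using less.prems(10) by simp
  define p where "p = x # w0 @ [y]"
  have len: "length p = ?n + 2" and distp: "distinct p" and setp: "set p = insert x (insert y (set w0))"
    using w0' xy by (auto simp: p_def)
  let ?R = "D - set w0"
  \<comment> \<open>Rerouting the path through \<open>w\<close> between positions \<open>i\<close>
    and \<open>j\<close> yields another path from \<open>x\<close> to \<open>y\<close>, so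
    \<open>w\<close> is no longer than the \<open>j - i - 1\<close> vertices it replaces.\<close>
  have exch: "length w + 1 \<le> j - i"
    if "W \<subseteq> ?R" "through E W (p ! i) w (p ! j)" "i < j" "j \<le> ?n + 1" for W w i j
  proof -
    have w: "w \<noteq> []" "distinct w" "set w \<subseteq> ?R" "successively E w" "E (p ! i) (hd w)" "E (last w) (p ! j)"
      using that by (auto simp: through_iff)
    let ?w = "take i w0 @ w @ drop (j - 1) w0"
    have "successively E (take (Suc i) p @ w @ drop j p)"
      using w that w0' len by (intro successively_replace) (auto simp: p_def)
    moreover have "take (Suc i) p = x # take i w0" using that by (simp add: p_def)
    moreover have "drop j p = drop (j - 1) w0 @ [y]"
      using that by (cases j) (auto simp: p_def)
    ultimately have "successively E (x # ?w @ [y])" by simp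
    moreover have "set (take i w0) \<inter> set (drop (j - 1) w0) = {}"
      using w0'(2) that by (intro set_take_disj_set_drop_if_distinct) auto
    then have "distinct ?w"
      using w w0'(2) by (auto dest: in_set_takeD in_set_dropD)
    moreover have "set ?w \<subseteq> D"
      using w w0'(3) by (auto dest: in_set_takeD in_set_dropD)
    ultimately have "through E D x ?w y" using w(1) by (simp add: through_def)
    then have "length ?w \<le> ?n" by (rule longest)
    then show ?thesis using that by simp
  qed
  have not_consec: False
    if c: "W \<subseteq> ?R" "conn_on E W" "f \<in> W" "E (p ! i) f" "g \<in> W" "E (p ! Suc i) g" "i \<le> ?n" for W f g i
  proof -
    obtain w where w: "through E W (p ! i) w (p ! Suc i)"
      using conn_on_through[OF sym c(2,3,5,4)] c(6) sym by (meson sympD)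
    then have "w \<noteq> []" by (simp add: through_def)
    then show False using exch[OF c(1) w] c(7) by simp
  qed
  have low: "card {u \<in> ?Z. E v u} < d" if "v \<in> set w0" "\<forall>f\<in>?R. \<not> E v f" for v
  proof -
    have "{u \<in> ?Z. E v u} \<subseteq> set p - {v}"
      using that irr by (auto simp: setp irreflp_def)
    then have "card {u \<in> ?Z. E v u} \<le> card (set p - {v})" by (intro card_mono) auto
    also have "\<dots> = ?n + 1" using that(1) distp by (simp add: setp distinct_card[symmetric] flip: len)
        (use distinct_card[OF distp] len setp in simp)
    finally show ?thesis using nd by simp
  qed
  have cardD: "card D = ?n + card ?R"
    using w0'(2,3) finD by (metis card_Diff_subset card_mono distinct_card finite_set le_add_diff_inverse)
  have comp: "sparse_bound E ?Z d ?c 1 U"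
    if U: "U \<subseteq> ?R" "U \<noteq> {}" "conn_on E U" "\<forall>u\<in>U. \<forall>v\<in>?R - U. \<not> E u v" for U
  proof -
    let ?A = "nbrs E ?Z U"
    let ?att = "\<lambda>l. \<exists>f\<in>U. E (p ! l) f"
    have AP: "?A \<subseteq> set p" using U by (auto simp: nbrs_def setp)
    have "2 \<le> card ?A" using U by (intro nb) auto
    then obtain b0 where "b0 \<in> ?A" by fastforce
    then have ex: "\<exists>l. l < length p \<and> p ! l \<in> ?A" using AP by (metis in_set_conv_nth subsetD)
    \<comment> \<open>With the first neighbour of \<open>U\<close> on the path in the role of
      \<open>a\<close>, every other one lies behind it.\<close>
    define i where "i = (LEAST l. l < length p \<and> p ! l \<in> ?A)"
    have i: "i < length p" "p ! i \<in> ?A"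
      using LeastI_ex[OF ex] by (auto simp: i_def)
    have imin: "i \<le> l" if "l < length p" "p ! l \<in> ?A" for l
      unfolding i_def using that by (intro Least_le) auto
    have att: "?att l" if "p ! l \<in> ?A" for l
      using that sym by (auto simp: nbrs_def dest: sympD)
    show ?thesis
    proof (rule sparse_bound_contract[of E ?Z U "p ! i" d k])
      show "U \<subseteq> ?Z" using U by auto
      show "d \<le> k" by fact
      show "\<And>V. V \<subseteq> U \<Longrightarrow> V \<noteq> {} \<Longrightarrow> 2 \<le> card (nbrs E ?Z V)" using U by (intro nb) auto
    next
      fix b w assume b: "b \<in> ?A" "b \<noteq> p ! i" and w: "through E U (p ! i) w b"
      obtain j where j: "j < length p" "b = p ! j" using b AP by (metis in_set_conv_nth subsetD)
      have "i < j" using imin[of j] j b by (cases "i = j") auto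
      let ?M = "{l. i < l \<and> l < j \<and> ?att l}"
      have "length w + 1 + 2 * card ?M \<le> j - i"
      proof (rule detour_arc[OF sym U(3) \<open>i < j\<close>])
        show "through E U (p ! i) w (p ! j)" using w j by simp
      qed (use exch U(1) j len in auto)
      \<comment> \<open>Neighbours of \<open>U\<close> sit at \<open>i\<close>, at \<open>j\<close>,
        between them, or at one of the \<open>?n + 1 - j\<close> positions after \<open>j\<close>.
        With the detour bound this gives \<open>length w + 1 + card ?A \<le> ?n + 3\<close>.\<close>
      moreover have "card ?A \<le> card ?M + ((?n + 1 - j) + 2)"
      proof -
        have "?A \<subseteq> (!) p ` (?M \<union> ({j<..?n + 1} \<union> {i, j}))"
        proof
          fix u assume u: "u \<in> ?A"
          then obtain l where l: "l < length p" "u = p ! l" using AP by (metis in_set_conv_nth subsetD)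
          then have "i \<le> l" "?att l" using imin att u by auto
          then have "l \<in> ?M \<union> ({j<..?n + 1} \<union> {i, j})" using l len by auto
          then show "u \<in> (!) p ` (?M \<union> ({j<..?n + 1} \<union> {i, j}))" using l by blast
        qed
        moreover have "finite (?M \<union> ({j<..?n + 1} \<union> {i, j}))" by auto
        ultimately have "card ?A \<le> card (?M \<union> ({j<..?n + 1} \<union> {i, j}))"
          by (rule surj_card_le[rotated])
        also have "\<dots> \<le> card ?M + card ({j<..?n + 1} \<union> {i, j})" by (rule card_Un_le)
        also have "card ({j<..?n + 1} \<union> {i, j}) \<le> card {j<..?n + 1} + card {i, j}" by (rule card_Un_le)
        finally show ?thesis using \<open>i < j\<close> by simp
      qed
      ultimately show "length w + 1 + card ?A < d + 2" using nd j len \<open>i < j\<close> by linarith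
    next
      fix E' x' y' d'
      assume *: "symp E'" "irreflp E'" "x' \<noteq> y'" "x' \<notin> U" "y' \<notin> U"
        "\<And>V. V \<subseteq> U \<Longrightarrow> V \<noteq> {} \<Longrightarrow> 2 \<le> card (nbrs E' (insert x' (insert y' U)) V)"
        "\<And>w. through E' U x' w y' \<Longrightarrow> length w + 1 < d'" "d' \<le> k"
      have "card U \<le> card ?R" using U(1) finD by (intro card_mono) auto
      moreover have "0 < ?n" using w0'(1) by simp
      ultimately have "card U < card D" using cardD by linarith
      moreover have "finite U" using U(1) finD finite_subset by blast
      ultimately show "sparse_bound E' (insert x' (insert y' U)) d' ?c 1 U"
        using less.hyps[of U E' x' y' d'] * U(2) by blast
    qed (use sym irr finZ U i in auto)
  qed
  show ?case
  proof (cases "?R = {}")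
    case True
    \<comment> \<open>With nothing off the path, a single inner vertex suffices, as
      \<open>card D = ?n \<le> k - 2\<close>.\<close>
    then have D: "D = set w0" using w0'(3) by auto
    obtain v where v: "v \<in> set w0" using w0'(1) by (meson last_in_set)
    have "card {u \<in> ?Z. E v u} < d" using low[OF v] True by simp
    moreover have "\<not> E v v" using irr by (simp add: irreflp_def)
    ultimately show ?thesis
      unfolding sparse_bound_def using v D nc cardD True by (intro exI[of _ "{v}"]) auto
  next
    case False
    have R: "sparse_bound E ?Z d ?c (if conn_on E ?R then 1 else 2) ?R"
      using finD False sym comp by (intro sparse_bound_components) auto
    show ?thesis
    proof (cases "conn_on E ?R")
      case False
      \<comment> \<open>The second unit of surplus pays for the \<open>?n \<le> k - 2\<close>
        vertices of the path.\<close>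
      then obtain I where "I \<subseteq> ?R" "\<forall>u\<in>I. \<forall>v\<in>I. \<not> E u v" "\<forall>v\<in>I. card {u \<in> ?Z. E v u} < d"
        "card ?R + 2 * ?c \<le> 2 * card I * ?c"
        using R by (auto simp: sparse_bound_def)
      then show ?thesis unfolding sparse_bound_def
        using cardD nc by (intro exI[of _ I]) auto
    next
      case conn: True
      \<comment> \<open>Otherwise two consecutive path vertices attach to \<open>?R\<close>: two
        inner ones, or the only inner one and a terminal, because \<open>?R\<close> has a second
        neighbour.\<close>
      have "\<exists>v\<in>set w0. \<forall>f\<in>?R. \<not> E v f"
      proof (rule ccontr)
        assume "\<not> ?thesis"
        then have all: "\<exists>f\<in>?R. E (p ! l) f" if "0 < l" "l \<le> ?n" for l
          using that by (auto simp: p_def nth_append nth_Cons')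
        show False
        proof (cases "?n = 1")
          case False
          then have "2 \<le> ?n" using w0'(1) by (cases w0) (auto simp: Suc_le_eq)
          then show False
            using all[of 1] all[of 2] not_consec[OF _ conn, of _ 1] by (auto simp: numeral_2_eq_2)
        next
          case True
          have "2 \<le> card (nbrs E ?Z ?R)" using False by (intro nb) auto
          then have "\<not> nbrs E ?Z ?R \<subseteq> {p ! 1}"
            using card_mono[of "{p ! 1}" "nbrs E ?Z ?R"] by auto
          then obtain u where u: "u \<in> nbrs E ?Z ?R" "u \<noteq> p ! 1" by blast
          then have "u \<in> set p" by (auto simp: nbrs_def setp)
          then obtain l where l: "l < length p" "u = p ! l" by (metis in_set_conv_nth)
          then have "l = 0 \<or> l = 2" using u(2) True len by (cases "l = 1") auto
          moreover obtain f where f: "f \<in> ?R" "E (p ! l) f"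
            using u(1) l(2) sym by (auto simp: nbrs_def dest: sympD)
          moreover obtain g where "g \<in> ?R" "E (p ! 1) g" using all[of 1] True by auto
          ultimately show False
            using not_consec[OF order_refl conn f(1), of 0 g] not_consec[OF order_refl conn _ _ f(1), of g 1] True
            by (auto simp: numeral_2_eq_2)
        qed
      qed
      then obtain v where v: "v \<in> set w0" "\<forall>f\<in>?R. \<not> E v f" by blast
      obtain I where I: "I \<subseteq> ?R" "\<forall>u\<in>I. \<forall>v\<in>I. \<not> E u v" "\<forall>v\<in>I. card {u \<in> ?Z. E v u} < d"
        "card ?R + ?c \<le> 2 * card I * ?c"
        using R conn by (auto simp: sparse_bound_def)
      have "finite I" "v \<notin> I" using I(1) finD v(1) by (auto intro: finite_subset)
      then have "card (insert v I) = card I + 1" by simp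
      then have "card D + ?c \<le> 2 * card (insert v I) * ?c"
        using I(4) cardD nc by (simp add: algebra_simps)
      moreover have "\<not> E v v" using irr by (simp add: irreflp_def)
      then have "\<forall>a\<in>insert v I. \<forall>b\<in>insert v I. \<not> E a b"
        using I(1,2) v(2) sym by (blast dest: sympD)
      moreover have "\<forall>a\<in>insert v I. card {u \<in> ?Z. E a u} < d" using I(3) low[OF v] by blast
      moreover have "insert v I \<subseteq> D" using I(1) v(1) w0'(3) by auto
      ultimately show ?thesis unfolding sparse_bound_def by (intro exI[of _ "insert v I"]) simp
    qed
  qed
qed

section \<open>Longest cycles\<close>

text \<open>The first vertex is not repeated at the end, so \<open>length p\<close> is the number of
  edges.\<close>

definition vcycle :: "('a \<Rightarrow> 'a \<Rightarrow> bool) \<Rightarrow> 'a set \<Rightarrow> 'a list \<Rightarrow> bool" where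
  "vcycle E V p \<longleftrightarrow> distinct p \<and> 3 \<le> length p \<and> set p \<subseteq> V \<and> successively E p \<and> E (last p) (hd p)"

lemma vcycle_swap:
  assumes "vcycle E V (xs @ ys)"
  shows "vcycle E V (ys @ xs)"
  using assms
  by (cases "xs = []"; cases "ys = []") (auto simp: vcycle_def successively_append_iff)

text \<open>Deleting \<open>a\<close> leaves a connected set, since a part cut off would have
  \<open>a\<close> as its only neighbour. Two neighbours of \<open>a\<close> are therefore joined by
  a path avoiding \<open>a\<close>, which closes up through \<open>a\<close>.\<close>

lemma ex_vcycle:
  assumes "finite V" "3 \<le> card V" "symp E"
    and nb: "\<And>U. U \<subseteq> V \<Longrightarrow> U \<noteq> {} \<Longrightarrow> 2 \<le> card (V - U) \<Longrightarrow> 2 \<le> card (nbrs E V U)"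
  obtains p where "vcycle E V p"
proof -
  obtain a where a: "a \<in> V" using assms(2) by fastforce
  have two: "\<exists>b c. b \<noteq> c \<and> b \<in> nbrs E V U \<and> c \<in> nbrs E V U"
    if "U \<subseteq> V" "U \<noteq> {}" "2 \<le> card (V - U)" for U
    using nb[OF that] by (metis card_le_Suc0_iff_eq card.infinite not_less_eq_eq numeral_2_eq_2
      le_zero_eq nat.distinct(1))
  have conn: "conn_on E (V - {a})"
    unfolding conn_on_def
  proof (intro allI impI)
    fix U assume U: "U \<subseteq> V - {a}" "U \<noteq> {}" "U \<noteq> V - {a}"
    then obtain b where b: "b \<in> V - {a}" "b \<notin> U" by blast
    have "card {a, b} \<le> card (V - U)" using a b U assms(1) by (intro card_mono) auto
    then have "2 \<le> card (V - U)" using b by auto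
    then obtain c where "c \<in> nbrs E V U" "c \<noteq> a" using two[of U] U by blast
    then show "\<exists>u\<in>U. \<exists>v\<in>V - {a} - U. E u v" by (auto simp: nbrs_def)
  qed
  have "2 \<le> card (V - {a})" using assms(1,2) a by simp
  then obtain b c where bc: "b \<noteq> c" "b \<in> nbrs E V {a}" "c \<in> nbrs E V {a}"
    using two[of "{a}"] a by blast
  then obtain z where z: "distinct (z @ [c])" "set z \<subseteq> V - {a} - {c}"
    "successively E (z @ [c])" "hd (z @ [c]) = b"
    using conn_on_link[OF assms(3) conn, of "{c}" b] by (auto simp: nbrs_def)
  have "z \<noteq> []" using z(4) bc(1) by auto
  then have "vcycle E V (a # z @ [c])"
    using z bc a assms(3)
    by (auto simp: vcycle_def nbrs_def successively_Cons Suc_le_eq dest: sympD)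
  then show thesis by (rule that)
qed

text \<open>Each detour through a component from the attachment \<open>a\<close> bounds both arcs of the cycle.\<close>

lemma sparse_bound_off_cycle:
  assumes fin: "finite V" and sym: "symp E" and irr: "irreflp E"
    and nb: "\<And>U. U \<subseteq> V \<Longrightarrow> U \<noteq> {} \<Longrightarrow> 2 \<le> card (V - U) \<Longrightarrow> 2 \<le> card (nbrs E V U)"
    and p: "vcycle E V p" and longest: "\<And>p'. vcycle E V p' \<Longrightarrow> length p' \<le> length p"
    and "length p < 2 * k" "V - set p \<noteq> {}"
  shows "sparse_bound E V k (k - 2) 1 (V - set p)"
proof (rule sparse_bound_le)
  let ?R = "V - set p"
  show "sparse_bound E V k (k - 2) (if conn_on E ?R then 1 else 2) ?R"
  proof (rule sparse_bound_components)
    fix U assume U: "U \<subseteq> ?R" "U \<noteq> {}" "conn_on E U" "\<forall>u\<in>U. \<forall>v\<in>?R - U. \<not> E u v"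
    let ?A = "nbrs E V U"
    have AP: "?A \<subseteq> set p" using U by (auto simp: nbrs_def)
    have finU: "finite U" using U(1) fin finite_subset by blast
    have nbU: "2 \<le> card (nbrs E V T)" if "T \<subseteq> U" "T \<noteq> {}" for T
    proof (rule nb)
      have "card (set p) \<le> card (V - T)"
        using that U p fin by (intro card_mono) (auto simp: vcycle_def)
      then show "2 \<le> card (V - T)" using p by (simp add: vcycle_def distinct_card)
    qed (use that U in auto)
    then obtain a where a: "a \<in> ?A" using U(2) by fastforce
    then obtain xs ys where "p = xs @ a # ys" using AP by (meson split_list subsetD)
    define r where "r = (a # ys) @ xs"
    have r: "vcycle E V r" "length r = length p" "set r = set p"
      using vcycle_swap[of E V xs "a # ys"] p \<open>p = xs @ a # ys\<close> by (auto simp: r_def)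
    define q where "q = length r"
    have q: "3 \<le> q" "q < 2 * k" using r assms(7) by (auto simp: vcycle_def q_def)
    have r0: "hd r = a" "r \<noteq> []" "r ! 0 = a" by (auto simp: r_def)
    \<comment> \<open>Index \<open>q\<close> repeats \<open>a\<close>, so the two arcs between
      \<open>a\<close> and \<open>v j\<close> become the index intervals from 0 to \<open>j\<close>
      and from \<open>j\<close> to \<open>q\<close>.\<close>
    define v where "v i = (r @ [a]) ! i" for i
    have vr: "v i = r ! i" if "i < q" for i using that by (simp add: v_def q_def nth_append)
    have v0: "v 0 = a" and vq: "v q = a" by (simp_all add: v_def q_def r_def)
    have exch: "length w + 1 \<le> j - i"
      if w: "through E U (v i) w (v j)" and ij: "i < j" "j \<le> q" "(i, j) \<noteq> (0, q)" for w i j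
    proof -
      have w': "w \<noteq> []" "distinct w" "set w \<subseteq> ?R" "successively E w" "E (v i) (hd w)" "E (last w) (v j)"
        using w U(1) by (auto simp: through_iff)
      let ?p = "take (Suc i) r @ w @ drop j r"
      have "successively E ?p"
        using w' ij r(1) vr by (intro successively_replace) (auto simp: vcycle_def q_def)
      moreover have "set (take (Suc i) r) \<inter> set (drop j r) = {}"
        using r(1) ij by (intro set_take_disj_set_drop_if_distinct) (auto simp: vcycle_def)
      then have "distinct ?p"
        using w'(2,3) r(1,3) by (auto simp: vcycle_def dest: in_set_takeD in_set_dropD)
      moreover have "set ?p \<subseteq> V"
        using w'(3) r(1) by (auto simp: vcycle_def dest: in_set_takeD in_set_dropD)
      moreover have "E (last ?p) (hd ?p)"
      proof (cases "j = q")
        case True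
        then show ?thesis using w' vq r0 by (simp add: q_def)
      next
        case False
        then show ?thesis using ij r(1) r0 by (simp add: q_def vcycle_def)
      qed
      \<comment> \<open>A list of fewer than three vertices is no cycle, but then
        \<open>q \<ge> 3\<close> bounds it anyway.\<close>
      ultimately have "length ?p \<le> q" if "3 \<le> length ?p"
        using that longest[of ?p] r(2) by (simp add: vcycle_def q_def)
      then have "length ?p \<le> q" using q(1) by linarith
      then show ?thesis using ij by (simp add: q_def)
    qed
    show "sparse_bound E V k (k - 2) 1 U"
    proof (rule sparse_bound_contract[of E V U a k k])
      fix b w assume b: "b \<in> ?A" "b \<noteq> a" and w: "through E U a w b"
      obtain j where j: "j < q" "b = v j"
        using b(1) AP r(3) vr by (metis in_set_conv_nth q_def subsetD)
      have "0 < j" using j b(2) v0 by (cases j) auto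
      let ?M = "\<lambda>i j. {l. i < l \<and> l < j \<and> (\<exists>f\<in>U. E (v l) f)}"
      have "length w + 1 + 2 * card (?M 0 j) \<le> j - 0"
        using \<open>0 < j\<close> j w v0 exch by (intro detour_arc[OF sym U(3)]) auto
      moreover have "length (rev w) + 1 + 2 * card (?M j q) \<le> q - j"
        using \<open>0 < j\<close> j through_rev[OF sym w] vq exch by (intro detour_arc[OF sym U(3)]) auto
      moreover have "card ?A \<le> card (?M 0 j) + (card (?M j q) + 2)"
      proof -
        have "?A \<subseteq> v ` (?M 0 j \<union> (?M j q \<union> {0, j}))"
        proof
          fix u assume u: "u \<in> ?A"
          then obtain l where l: "l < q" "u = v l"
            using AP r(3) vr by (metis in_set_conv_nth q_def subsetD)
          have "\<exists>f\<in>U. E (v l) f" using u l(2) sym by (auto simp: nbrs_def dest: sympD)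
          then have "l \<in> ?M 0 j \<union> (?M j q \<union> {0, j})" using l by auto
          then show "u \<in> v ` (?M 0 j \<union> (?M j q \<union> {0, j}))" using l by blast
        qed
        moreover have "finite (?M 0 j \<union> (?M j q \<union> {0, j}))" by auto
        ultimately have "card ?A \<le> card (?M 0 j \<union> (?M j q \<union> {0, j}))"
          by (rule surj_card_le[rotated])
        also have "\<dots> \<le> card (?M 0 j) + card (?M j q \<union> {0, j})" by (rule card_Un_le)
        also have "card (?M j q \<union> {0, j}) \<le> card (?M j q) + card {0, j}" by (rule card_Un_le)
        finally show ?thesis using \<open>0 < j\<close> by simp
      qed
      \<comment> \<open>Adding the bounds for both arcs gives 2(|w| + 1) + 2(|A| - 2) \<le> q <
        2k.\<close>
      ultimately show "length w + 1 + card ?A < k + 2" using q(2) j(1) by simp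
    next
      fix E' x y d'
      assume "symp E'" "irreflp E'" "x \<noteq> y" "x \<notin> U" "y \<notin> U"
        "\<And>T. T \<subseteq> U \<Longrightarrow> T \<noteq> {} \<Longrightarrow> 2 \<le> card (nbrs E' (insert x (insert y U)) T)"
        "\<And>w. through E' U x w y \<Longrightarrow> length w + 1 < d'" "d' \<le> k"
      then show "sparse_bound E' (insert x (insert y U)) d' (k - 2) 1 U"
        using U(2) finU by (intro sparse_bound_linked)
    qed (use sym irr fin U a nbU in auto)
  qed (use fin assms(8) sym in auto)
qed simp

section \<open>From 2-connected graphs, closed walks and arc degrees to the relation
  \<open>dominates G\<close> and vertex lists\<close>

lemma (in graph) two_connected_nbrs:
  assumes "two_connected G" "U \<subseteq> verts G" "U \<noteq> {}" "2 \<le> card (verts G - U)"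
  shows "2 \<le> card (nbrs (dominates G) (verts G) U)"
proof (rule ccontr)
  let ?N = "nbrs (dominates G) (verts G) U"
  assume "\<not> ?thesis"
  moreover have "finite ?N" by (simp add: nbrs_def)
  ultimately have one: "b = c" if "b \<in> ?N" "c \<in> ?N" for b c
    using that card_le_Suc0_iff_eq[of ?N] by auto
  have "\<exists>b c. b \<noteq> c \<and> b \<in> verts G - U \<and> c \<in> verts G - U"
    using assms(4) card_le_Suc0_iff_eq[of "verts G - U"] by fastforce
  then obtain b c where bc: "b \<noteq> c" "b \<in> verts G - U" "c \<in> verts G - U" by blast
  \<comment> \<open>Let \<open>w\<close> be the only neighbour of \<open>U\<close>, or any vertex
    outside \<open>U\<close> if there is none. Without \<open>w\<close> nothing outside
    \<open>U\<close> can be reached from \<open>U\<close>, yet \<open>z\<close> can, as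
    \<open>w\<close> is no cut-vertex.\<close>
  obtain w z where wz: "w \<in> verts G - U" "z \<in> verts G - U" "w \<noteq> z" "?N \<subseteq> {w}"
  proof (cases "?N \<subseteq> {b}")
    case False
    then obtain w where w: "w \<in> ?N" "w \<noteq> b" by blast
    then have "?N \<subseteq> {w}" "w \<in> verts G - U" using one by (auto simp: nbrs_def)
    then show thesis using that bc w by blast
  qed (use that bc in blast)
  obtain u where u: "u \<in> U" using assms(3) by blast
  have "strongly_connected G"
    using assms(1) sym_arcs symmetric_connected_imp_strongly_connected by (simp add: two_connected_def)
  then have "u \<rightarrow>\<^sup>* z" using u wz assms(2) by blast
  moreover have "\<not> cut_vertex G w" using assms(1) by (simp add: two_connected_def)
  ultimately have "u \<rightarrow>\<^sup>*\<^bsub>del_vert w\<^esub> z"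
    using u wz assms(2) unfolding cut_vertex_def by blast
  then have "z \<in> U"
  proof (induction rule: wf_digraph.reachable_induct[OF wf_digraph_del_vert, consumes 1, case_names base step])
    case base
    then show ?case using u by simp
  next
    case (step x y)
    then have "x \<rightarrow>\<^bsub>G\<^esub> y" "y \<noteq> w" by (auto simp: arcs_ends_conv del_vert_simps)
    then have "y \<in> ?N" if "y \<notin> U" using step that by (auto simp: nbrs_def adj_in_verts)
    then show ?case using \<open>y \<noteq> w\<close> wz(4) by blast
  qed
  then show False using wz by simp
qed

lemma (in graph) awalk_of_successively:
  assumes "successively (dominates G) (u # p)" "u \<in> verts G"
  obtains es where "awalk u es (last (u # p))" "awalk_verts u es = u # p"
  using assms
proof (induction p arbitrary: u thesis)
  case Nil
  then show ?case using awalk_Nil_iff[of u u] by (metis awalk_verts.simps(1) last.simps)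
next
  case (Cons v p)
  then have "u \<rightarrow>\<^bsub>G\<^esub> v" "v \<in> verts G" by (auto simp: adj_in_verts)
  moreover obtain es where "awalk v es (last (v # p))" "awalk_verts v es = v # p"
    using Cons \<open>v \<in> verts G\<close> by auto
  moreover obtain e where "e \<in> arcs G" "tail G e = u" "head G e = v"
    using \<open>u \<rightarrow>\<^bsub>G\<^esub> v\<close> by (rule reachableE)
  ultimately show ?case
    using Cons.prems by (intro Cons.prems(1)[of "e # es"]) (auto simp: awalk_Cons_iff)
qed

text \<open>This makes the set of cycle lengths finite, so that \<open>Max\<close> in
  \<open>circumference\<close> is a true maximum.\<close>

lemma (in graph) length_cycle_le:
  assumes "ugraph_cycle G p"
  shows "length p \<le> card (verts G)"
proof -
  obtain u where u: "awalk u p u" "distinct (tl (awalk_verts u p))"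
    using assms by (auto simp: ugraph_cycle_def cycle_def)
  have "length p = card (set (tl (awalk_verts u p)))"
    using u(2) by (simp add: distinct_card length_awalk_verts)
  also have "\<dots> \<le> card (verts G)"
    using u(1) by (intro card_mono) (auto elim!: awalkE dest: list.set_sel(2)[rotated])
  finally show ?thesis .
qed

lemma (in graph) vcycle_le_circumference:
  assumes "vcycle (dominates G) (verts G) p"
  shows "length p \<le> circumference G"
proof -
  have p: "distinct p" "3 \<le> length p" "set p \<subseteq> verts G" "successively (dominates G) p"
    "last p \<rightarrow>\<^bsub>G\<^esub> hd p"
    using assms by (auto simp: vcycle_def)
  obtain a ps where ps: "p = a # ps" using p(2) by (cases p) auto
  have "successively (dominates G) (a # ps @ [a])"
    using p(4,5) ps by (simp add: successively_append_iff flip: append_Cons)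
  then obtain es where es: "awalk a es (last (a # ps @ [a]))" "awalk_verts a es = a # ps @ [a]"
    using awalk_of_successively[of a "ps @ [a]"] p(3) ps by auto
  have len: "length es = length p" using length_awalk_verts[of a es] es(2) ps by simp
  have "cycle es"
    unfolding cycle_def using es p(1,2) ps len by (intro exI[of _ a]) auto
  then have "ugraph_cycle G es" using len p(2) by (simp add: ugraph_cycle_def)
  moreover have "finite {length p |p. ugraph_cycle G p}"
    by (rule finite_subset[of _ "{..card (verts G)}"]) (auto dest: length_cycle_le)
  ultimately show ?thesis
    unfolding circumference_def len[symmetric] by (intro Max_ge) auto
qed

lemma (in graph) out_degree_conv_card:
  "out_degree G v = card {u \<in> verts G. v \<rightarrow>\<^bsub>G\<^esub> u}"
proof -
  have "bij_betw (head G) (out_arcs G v) {u \<in> verts G. v \<rightarrow>\<^bsub>G\<^esub> u}"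
    unfolding bij_betw_def
  proof
    show "inj_on (head G) (out_arcs G v)"
      by (auto simp: inj_on_def out_arcs_def arc_to_ends_def intro: no_multi_arcs)
    show "head G ` out_arcs G v = {u \<in> verts G. v \<rightarrow>\<^bsub>G\<^esub> u}"
      by (auto simp: out_arcs_def arcs_ends_conv image_iff)
  qed
  then show ?thesis unfolding out_degree_def by (rule bij_betw_same_card)
qed

theorem theorem2p9:
  fixes G :: "('a, 'b) pre_digraph" and k s :: nat
  assumes "k \<ge> 1" and "s \<ge> 1"
    and "graph G" and "two_connected G"
    and "card (verts G) \<ge> 2 * k * (s + 1)"
    and "\<And>S. independent_set G S \<Longrightarrow> card S = s + 1 \<Longrightarrow> Max {out_degree G v | v. v \<in> S} \<ge> k"
  shows "circumference G \<ge> 2 * k"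
proof (rule ccontr)
  interpret graph G by fact
  let ?E = "dominates G" and ?V = "verts G"
  assume "\<not> ?thesis"
  then have short: "length p < 2 * k" if "vcycle ?E ?V p" for p
    using vcycle_le_circumference[OF that] by simp
  have sym: "symp ?E" using sym_arcs by (simp add: symmetric_def symp_def sym_def)
  have irr: "irreflp ?E" by (auto simp: irreflp_def dest: adj_not_same)
  note nb = two_connected_nbrs[OF assms(4)]
  have "3 \<le> card ?V" using assms(4) by (simp add: two_connected_def)
  then obtain p0 where "vcycle ?E ?V p0"
    by (rule ex_vcycle[OF finite_verts _ sym nb])
  then obtain p where p: "vcycle ?E ?V p" and longest: "\<And>p'. vcycle ?E ?V p' \<Longrightarrow> length p' \<le> length p"
    using ex_has_greatest_nat[of "vcycle ?E ?V" p0 length "2 * k"] short by blast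
  have "card (?V - set p) = card ?V - length p"
    using p by (simp add: vcycle_def card_Diff_subset distinct_card)
  then have large: "2 * k * s < card (?V - set p)"
    using assms(5) short[OF p] by (simp add: algebra_simps)
  have "sparse_bound ?E ?V k (k - 2) 1 (?V - set p)"
  proof (rule sparse_bound_off_cycle)
    show "2 \<le> card (nbrs ?E ?V U)" if "U \<subseteq> ?V" "U \<noteq> {}" "2 \<le> card (?V - U)" for U
      using that by (rule nb)
    show "length p' \<le> length p" if "vcycle ?E ?V p'" for p' using that by (rule longest)
    show "?V - set p \<noteq> {}" using large by (metis card.empty not_less_zero)
  qed (fact finite_verts sym irr p short[OF p])+
  then obtain I where I: "I \<subseteq> ?V - set p" "\<forall>u\<in>I. \<forall>v\<in>I. \<not> u \<rightarrow>\<^bsub>G\<^esub> v"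
    "\<forall>v\<in>I. card {u \<in> ?V. v \<rightarrow>\<^bsub>G\<^esub> u} < k" "card (?V - set p) + 1 * (k - 2) \<le> 2 * card I * (k - 2)"
    unfolding sparse_bound_def by blast
  \<comment> \<open>With |I| \<le> s the bound would leave room for at most 2ks vertices off the
    cycle.\<close>
  have "s + 1 \<le> card I"
  proof (rule ccontr)
    assume "\<not> ?thesis"
    then have "2 * card I * (k - 2) \<le> 2 * s * k" by (intro mult_le_mono) auto
    moreover have "2 * s * k = 2 * k * s" by simp
    ultimately show False using I(4) large by linarith
  qed
  then obtain S where S: "S \<subseteq> I" "card S = s + 1" by (metis obtain_subset_with_card_n)
  have "independent_set G S" using S(1) I(1,2) by (auto simp: independent_set_def)
  then have "k \<le> Max {out_degree G v |v. v \<in> S}" using S(2) assms(6) by blast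
  \<comment> \<open>Positive cardinality makes \<open>S\<close> finite and nonempty, so
    \<open>Max\<close> is attained at a vertex of \<open>I\<close>.\<close>
  moreover have "finite S" "S \<noteq> {}" using S(2) card_ge_0_finite[of S] by auto
  then have "Max (out_degree G ` S) < k"
    using S(1) I(3) by (subst Max_less_iff) (auto simp: out_degree_conv_card)
  ultimately show False by (simp add: Setcompr_eq_image)
qed

end
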